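(* Let $d\ge 1$. Every ideal in $\mathcal{A}_d=\mathbb{C}[z_1,\dots,z_d]$ is linearly equivalent to an ideal of $\mathcal{A}_d$ that has the stable division property with respect to the $\ell_1$ norm.
   Context: The $\ell_1$ norm on $\mathcal{A}_d$ is $\|p\|=\sum_\alpha|c_\alpha|$ for $p(z)=\sum_\alpha c_\alpha z^\alpha$. An ideal $I\subseteq\mathcal{A}_d$ has the stable division property (with respect to a norm $\|\cdot\|$) if there are a finite set $\{f_1,\dots,f_k\}\subset I$ generating $I$ and a constant $C$ such that every $h\in I$ can be written $h=a_1f_1+\dots+a_kf_k$ with $a_i\in\mathcal{A}_d$ and $\sum_i\|a_if_i\|^2\le C\|h\|^2$. (For a fixed finite generating set this is equivalent to $\sum_i\|a_if_i\|\le C'\|h\|$ for some constant $C'$.) Two ideals $I,J\subseteq\mathcal{A}_d$ are linearly equivalent if there is an (invertible) linear change of variables that sends $I$ onto $J$. *)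

theory Defs
  imports "HOL-Analysis.Analysis" "HOL-Library.Poly_Mapping"
begin

text \<open>
  The polynomial ring \<open>\<A>\<^sub>d = \<complex>[z\<^sub>1, \<dots>, z\<^sub>d]\<close> is the type \<open>'n cpoly\<close> with \<open>'n :: finite\<close> and
  \<open>d = CARD('n) \<ge> 1\<close>. A polynomial is the finitely supported map sending an exponent
  \<open>\<alpha> :: 'n \<Rightarrow>\<^sub>0 nat\<close> to the coefficient of \<open>z\<^sup>\<alpha>\<close>; multiplication is convolution.
\<close>

type_synonym 'n cpoly = "('n \<Rightarrow>\<^sub>0 nat) \<Rightarrow>\<^sub>0 complex"

definition const_poly :: "complex \<Rightarrow> 'n cpoly" where
  "const_poly c = Poly_Mapping.single 0 c"

definition var_poly :: "'n \<Rightarrow> 'n cpoly" where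
  "var_poly i = Poly_Mapping.single (Poly_Mapping.single i 1) 1"

definition l1_norm :: "'n cpoly \<Rightarrow> real" where
  "l1_norm p = (\<Sum>\<alpha>\<in>Poly_Mapping.keys p. cmod (Poly_Mapping.lookup p \<alpha>))"

text \<open>Ideals are the submodules of a commutative ring regarded as a module over itself.\<close>

lemma module_times: "module ((*) :: 'a \<Rightarrow> 'a \<Rightarrow> 'a :: comm_ring_1)"
  by unfold_locales (simp_all add: algebra_simps)

definition ring_ideal :: "'a :: comm_ring_1 set \<Rightarrow> bool" where
  "ring_ideal I \<longleftrightarrow> module.subspace (*) I"

definition ideal_generated_by :: "'a :: comm_ring_1 set \<Rightarrow> 'a set" where
  "ideal_generated_by F = module.span (*) F"

lemma ring_ideal_iff:
  "ring_ideal I \<longleftrightarrow> 0 \<in> I \<and> (\<forall>x\<in>I. \<forall>y\<in>I. x + y \<in> I) \<and> (\<forall>a. \<forall>x\<in>I. a * x \<in> I)"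
  unfolding ring_ideal_def module.subspace_def[OF module_times] by auto

lemma ideal_generated_by_eq:
  "ideal_generated_by F = \<Inter> {J. ring_ideal J \<and> F \<subseteq> J}"
  unfolding ideal_generated_by_def ring_ideal_def module.span_def[OF module_times]
    module.span_alt[OF module_times] hull_def
  by auto

definition stable_division_property :: "('n cpoly \<Rightarrow> real) \<Rightarrow> 'n cpoly set \<Rightarrow> bool" where
  "stable_division_property N I \<longleftrightarrow>
     (\<exists>F C. finite F \<and> F \<subseteq> I \<and> ideal_generated_by F = I \<and>
        (\<forall>h\<in>I. \<exists>a. h = (\<Sum>f\<in>F. a f * f) \<and> (\<Sum>f\<in>F. (N (a f * f))\<^sup>2) \<le> C * (N h)\<^sup>2))"

text \<open>
  \<open>linear_subst M p\<close> is \<open>p(M z)\<close>, obtained by replacing each variable \<open>z\<^sub>i\<close> by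
  \<open>\<Sum>\<^sub>j M\<^sub>i\<^sub>j z\<^sub>j\<close>.
\<close>

definition linear_subst :: "complex ^ 'n ^ 'n \<Rightarrow> 'n :: finite cpoly \<Rightarrow> 'n cpoly" where
  "linear_subst M p =
     (\<Sum>\<alpha>\<in>Poly_Mapping.keys p. const_poly (Poly_Mapping.lookup p \<alpha>) *
        (\<Prod>i\<in>UNIV. (\<Sum>j\<in>UNIV. const_poly (M $ i $ j) * var_poly j) ^ Poly_Mapping.lookup \<alpha> i))"

definition linearly_equivalent :: "'n :: finite cpoly set \<Rightarrow> 'n cpoly set \<Rightarrow> bool" where
  "linearly_equivalent I J \<longleftrightarrow> (\<exists>M :: complex ^ 'n ^ 'n. invertible M \<and> linear_subst M ` I = J)"

end

theory Submission
  imports Defs "HOL-Computational_Algebra.Primes"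
begin

text \<open>
  Distinct primes \<open>p\<^sub>i\<close> give the monomial order \<open>\<alpha> \<mapsto> \<phi> \<alpha> = \<Prod>\<^sub>i p\<^sub>i^\<alpha>\<^sub>i\<close>, which is injective by unique
  factorisation, multiplicative and takes values in the well-ordered set \<open>\<nat>\<close>. The substitution
  \<open>z\<^sub>i \<mapsto> p\<^sub>i^s z\<^sub>i\<close> multiplies the coefficient of \<open>z^\<alpha>\<close> by \<open>\<phi> \<alpha> ^ s\<close>, so for large \<open>s\<close> every element of a
  fixed Groebner basis is, once made monic again, within \<open>1/2\<close> of its leading monomial in the \<open>\<ell>\<^sub>1\<close> norm.
  For such a basis a division step that cancels the leading coefficient \<open>c\<close> of \<open>h\<close> decreases
  \<open>\<parallel>h\<parallel>\<close> by at least \<open>\<bar>c\<bar>/2\<close>; summing over all steps, the quotients have total norm at most \<open>2\<parallel>h\<parallel>\<close>.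
\<close>

section \<open>The \<open>l1_norm\<close>: monomial expansions, triangle inequality,
  products\<close>

lemma single_poly_sum:
  "(\<Sum>\<alpha>\<in>Poly_Mapping.keys h. Poly_Mapping.single \<alpha> (Poly_Mapping.lookup h \<alpha>)) = h"
  by (rule poly_mapping_eqI) (simp add: lookup_sum lookup_single when_def in_keys_iff)

lemma lookup_const_poly_mult [simp]:
  "Poly_Mapping.lookup (const_poly c * h) \<alpha> = c * Poly_Mapping.lookup h \<alpha>"
  by (simp add: const_poly_def map.rep_eq when_def flip: mult_map_scale_conv_mult)

lemma l1_norm_superset:
  assumes "finite A" "Poly_Mapping.keys h \<subseteq> A"
  shows "l1_norm h = (\<Sum>\<alpha>\<in>A. cmod (Poly_Mapping.lookup h \<alpha>))"
  unfolding l1_norm_def using assms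
  by (intro sum.mono_neutral_left) (auto simp: in_keys_iff)

lemma l1_norm_zero [simp]: "l1_norm 0 = 0"
  by (simp add: l1_norm_def)

lemma l1_norm_nonneg [simp]: "0 \<le> l1_norm h"
  by (simp add: l1_norm_def sum_nonneg)

lemma l1_norm_single [simp]: "l1_norm (Poly_Mapping.single \<alpha> c) = cmod c"
  by (simp add: l1_norm_def)

lemma l1_norm_add_le: "l1_norm (g + h) \<le> l1_norm g + l1_norm h"
proof -
  define A where "A = Poly_Mapping.keys g \<union> Poly_Mapping.keys h"
  have "finite A" by (simp add: A_def)
  moreover have "Poly_Mapping.keys (g + h) \<subseteq> A" unfolding A_def by (rule keys_add)
  moreover have "Poly_Mapping.keys g \<subseteq> A" "Poly_Mapping.keys h \<subseteq> A" by (auto simp: A_def)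
  ultimately show ?thesis
    by (simp add: l1_norm_superset[of A] lookup_add norm_triangle_ineq sum_mono flip: sum.distrib)
qed

lemma l1_norm_uminus [simp]: "l1_norm (- h) = l1_norm h"
  by (simp add: l1_norm_def)

lemma l1_norm_diff_le: "l1_norm (g - h) \<le> l1_norm g + l1_norm h"
  using l1_norm_add_le[of g "- h"] by simp

lemma l1_norm_sum_le: "l1_norm (\<Sum>x\<in>A. f x) \<le> (\<Sum>x\<in>A. l1_norm (f x))"
proof (induction A rule: infinite_finite_induct)
  case (insert x A)
  then show ?case using l1_norm_add_le[of "f x" "sum f A"] by simp
qed simp_all

text \<open>Both factors are expanded into monomials. The norms of the pairwise products add up to
  exactly the right-hand side, and collecting equal exponents can only lose norm.\<close>

lemma l1_norm_mult_le: "l1_norm (g * h) \<le> l1_norm g * l1_norm h"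
proof -
  have "g * h = (\<Sum>\<alpha>\<in>Poly_Mapping.keys g. \<Sum>\<beta>\<in>Poly_Mapping.keys h.
      Poly_Mapping.single (\<alpha> + \<beta>) (Poly_Mapping.lookup g \<alpha> * Poly_Mapping.lookup h \<beta>))"
    by (subst (1 2) single_poly_sum[symmetric]) (simp add: sum_product mult_single)
  also have "l1_norm \<dots> \<le> (\<Sum>\<alpha>\<in>Poly_Mapping.keys g. \<Sum>\<beta>\<in>Poly_Mapping.keys h.
      cmod (Poly_Mapping.lookup g \<alpha>) * cmod (Poly_Mapping.lookup h \<beta>))"
    by (intro order.trans[OF l1_norm_sum_le] sum_mono) (auto simp: norm_mult)
  also have "\<dots> = l1_norm g * l1_norm h"
    by (simp add: l1_norm_def sum_product)
  finally show ?thesis .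
qed

text \<open>Special to \<open>l1_norm\<close>: terms contribute independently, so deleting one gains
  its full modulus. This gain pays for the error made by a division step.\<close>

lemma l1_norm_diff_single:
  "l1_norm (h - Poly_Mapping.single \<alpha> (Poly_Mapping.lookup h \<alpha>)) =
     l1_norm h - cmod (Poly_Mapping.lookup h \<alpha>)"
proof -
  define A where "A = insert \<alpha> (Poly_Mapping.keys h)"
  have A: "finite A" "Poly_Mapping.keys h \<subseteq> A" "\<alpha> \<in> A" by (auto simp: A_def)
  have "Poly_Mapping.keys (h - Poly_Mapping.single \<alpha> (Poly_Mapping.lookup h \<alpha>)) \<subseteq> A"
    by (auto simp: A_def in_keys_iff lookup_minus lookup_single when_def split: if_splits)
  then have "l1_norm (h - Poly_Mapping.single \<alpha> (Poly_Mapping.lookup h \<alpha>)) =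
      (\<Sum>\<beta>\<in>A. if \<beta> = \<alpha> then 0 else cmod (Poly_Mapping.lookup h \<beta>))"
    using A by (subst l1_norm_superset[of A])
      (auto simp: lookup_minus lookup_single when_def intro!: sum.cong)
  also have "\<dots> = (\<Sum>\<beta>\<in>A - {\<alpha>}. cmod (Poly_Mapping.lookup h \<beta>))"
    using A by (simp add: sum.remove)
  also have "\<dots> = l1_norm h - cmod (Poly_Mapping.lookup h \<alpha>)"
    using A by (simp add: l1_norm_superset[of A] sum_diff1)
  finally show ?thesis .
qed

section \<open>Dickson's lemma\<close>

text \<open>Coordinates are treated one after another, each time passing to a subsequence on which
  the new coordinate is nondecreasing; the earlier ones stay so. In the end all coordinates are
  monotone, and the first two terms form the pair.\<close>

lemma dickson_good_pair:
  fixes f :: "nat \<Rightarrow> 'n :: finite \<Rightarrow> nat"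
  shows "\<exists>i j. i < j \<and> (\<forall>k. f i k \<le> f j k)"
proof -
  have "\<exists>r :: nat \<Rightarrow> nat. strict_mono r \<and> (\<forall>k\<in>K. \<forall>i j. i \<le> j \<longrightarrow> f (r i) k \<le> f (r j) k)"
    if "finite K" for K
    using that
  proof induction
    case empty
    show ?case by (intro exI[of _ id]) (simp add: strict_mono_def)
  next
    case (insert k K)
    then obtain r :: "nat \<Rightarrow> nat" where r: "strict_mono r"
      "\<And>k i j. k \<in> K \<Longrightarrow> i \<le> j \<Longrightarrow> f (r i) k \<le> f (r j) k" by blast
    have "\<exists>q. strict_mono q \<and> incseq (\<lambda>n. f (r (q n)) k)"
    proof -
      \<comment> \<open>Take for \<open>n\<close> a position where the tail starting at
        \<open>m\<close> attains its minimum.\<close>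
      have "\<exists>n\<ge>m. \<forall>l\<ge>n. f (r n) k \<le> f (r l) k" for m
      proof -
        obtain n where "n \<ge> m" "\<And>l. l \<ge> m \<Longrightarrow> f (r n) k \<le> f (r l) k"
          using ex_has_least_nat[of "\<lambda>n. n \<ge> m" m "\<lambda>n. f (r n) k"] by auto
        then show ?thesis by (meson order.trans)
      qed
      then obtain N where N: "\<And>m. N m \<ge> m" "\<And>m l. l \<ge> N m \<Longrightarrow> f (r (N m)) k \<le> f (r l) k"
        by metis
      \<comment> \<open>\<open>N\<close> returns positions of tail minima. Restarting the search at
        \<open>Suc x\<close> makes \<open>q\<close> strictly increasing, and every
        \<open>q n\<close> is a tail minimum, so the values along \<open>q\<close> cannot
        drop.\<close>
      define q where "q = rec_nat (N 0) (\<lambda>_ x. N (Suc x))"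
      have q: "q (Suc n) > q n" for n
        using N(1)[of "Suc (q n)"] by (simp add: q_def)
      have "f (r (q n)) k \<le> f (r (q (Suc n))) k" for n
      proof -
        have "\<exists>m. q n = N m" by (cases n) (auto simp: q_def)
        then show ?thesis using N(2) q by (metis order.strict_implies_order)
      qed
      then show ?thesis using q by (intro exI[of _ q]) (simp add: strict_mono_Suc_iff incseq_SucI)
    qed
    then obtain q where q: "strict_mono q" "incseq (\<lambda>n. f (r (q n)) k)" by blast
    have "strict_mono (r \<circ> q)" using r(1) q(1) by (rule strict_mono_o)
    moreover have "\<forall>k'\<in>insert k K. \<forall>i j. i \<le> j \<longrightarrow> f ((r \<circ> q) i) k' \<le> f ((r \<circ> q) j) k'"
      using r(2) q by (auto simp: incseq_def strict_mono_less_eq)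
    ultimately show ?case by blast
  qed
  from this[of UNIV] obtain r :: "nat \<Rightarrow> nat" where
    "strict_mono r" "\<And>k i j. i \<le> j \<Longrightarrow> f (r i) k \<le> f (r j) k" by auto
  then show ?thesis by (intro exI[of _ "r 0"] exI[of _ "r 1"]) (simp add: strict_mono_less)
qed

text \<open>\<open>B\<close> consists of the minimal elements of \<open>A\<close> in the
  componentwise order. They form an antichain, which the good-pair lemma forces to be
  finite.\<close>

lemma dickson:
  fixes A :: "('n :: finite \<Rightarrow>\<^sub>0 nat) set"
  shows "\<exists>B\<subseteq>A. finite B \<and> (\<forall>\<alpha>\<in>A. \<exists>\<beta>\<in>B. \<exists>\<gamma>. \<alpha> = \<beta> + \<gamma>)"
proof -
  define le where "le \<beta> \<alpha> \<longleftrightarrow> (\<forall>k. Poly_Mapping.lookup \<beta> k \<le> Poly_Mapping.lookup \<alpha> k)"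
    for \<beta> \<alpha> :: "'n \<Rightarrow>\<^sub>0 nat"
  define d where "d \<alpha> = (\<Sum>k\<in>UNIV. Poly_Mapping.lookup \<alpha> k)" for \<alpha> :: "'n \<Rightarrow>\<^sub>0 nat"
  define B where "B = {\<beta>\<in>A. \<forall>\<alpha>\<in>A. le \<alpha> \<beta> \<longrightarrow> \<alpha> = \<beta>}"
  have "finite B"
  proof (rule ccontr)
    assume "infinite B"
    then obtain f :: "nat \<Rightarrow> 'n \<Rightarrow>\<^sub>0 nat" where f: "inj f" "range f \<subseteq> B"
      using infinite_countable_subset by blast
    obtain i j where "i < j" "le (f i) (f j)"
      using dickson_good_pair[of "\<lambda>n. Poly_Mapping.lookup (f n)"] by (auto simp: le_def)
    moreover from this f(2) have "f i = f j" unfolding B_def by blast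
    ultimately show False using f(1) by (simp add: inj_eq)
  qed
  moreover have "\<exists>\<beta>\<in>B. \<exists>\<gamma>. \<alpha> = \<beta> + \<gamma>" if "\<alpha> \<in> A" for \<alpha>
  proof -
    \<comment> \<open>An element of \<open>A\<close> below \<open>\<alpha>\<close> of least total
      degree is minimal in \<open>A\<close>: anything strictly below it would also lie below
      \<open>\<alpha>\<close> and have smaller degree.\<close>
    obtain \<beta> where \<beta>: "\<beta> \<in> A" "le \<beta> \<alpha>" "\<And>\<gamma>. \<gamma> \<in> A \<Longrightarrow> le \<gamma> \<alpha> \<Longrightarrow> d \<beta> \<le> d \<gamma>"
      using ex_has_least_nat[of "\<lambda>\<beta>. \<beta> \<in> A \<and> le \<beta> \<alpha>" \<alpha> d] \<open>\<alpha> \<in> A\<close>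
      unfolding le_def by blast
    have "\<gamma> = \<beta>" if \<gamma>: "\<gamma> \<in> A" "le \<gamma> \<beta>" for \<gamma>
    proof (rule ccontr)
      assume "\<gamma> \<noteq> \<beta>"
      then obtain k where "Poly_Mapping.lookup \<gamma> k < Poly_Mapping.lookup \<beta> k"
        using \<gamma>(2) by (metis le_def order_le_less poly_mapping_eqI)
      then have "d \<gamma> < d \<beta>"
        unfolding d_def using \<gamma>(2) by (intro sum_strict_mono_ex1) (auto simp: le_def)
      moreover have "le \<gamma> \<alpha>" using \<gamma>(2) \<beta>(2) unfolding le_def by (meson order.trans)
      ultimately show False using \<beta>(3)[OF \<gamma>(1)] by simp
    qed
    then have "\<beta> \<in> B" using \<beta> by (simp add: B_def)
    moreover have "\<alpha> = \<beta> + (\<alpha> - \<beta>)"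
      using \<beta>(2) by (intro poly_mapping_eqI) (simp add: le_def lookup_add lookup_minus)
    ultimately show ?thesis by blast
  qed
  ultimately show ?thesis by (intro exI[of _ B]) (auto simp: B_def)
qed

section \<open>Diagonal substitutions and prime-power weights\<close>

lemma single_power:
  "Poly_Mapping.single (Poly_Mapping.single i 1) c ^ n =
     (Poly_Mapping.single (Poly_Mapping.single i n) (c ^ n) :: 'n cpoly)"
  by (induction n) (simp_all add: mult_single flip: single_add single_one)

lemma prod_single:
  "(\<Prod>i\<in>A. Poly_Mapping.single (f i) (c i)) =
     (Poly_Mapping.single (\<Sum>i\<in>A. f i) (\<Prod>i\<in>A. c i) :: 'n cpoly)"
  by (induction A rule: infinite_finite_induct) (simp_all add: mult_single)

lemma sum_single_exponent:
  fixes \<alpha> :: "'n :: finite \<Rightarrow>\<^sub>0 nat"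
  shows "(\<Sum>i\<in>UNIV. Poly_Mapping.single i (Poly_Mapping.lookup \<alpha> i)) = \<alpha>"
  by (rule poly_mapping_eqI) (simp add: lookup_sum lookup_single when_def)

text \<open>A diagonal substitution sends each monomial to a multiple of itself, so no two exponents
  are ever mixed.\<close>

lemma lookup_linear_subst_diagonal:
  assumes "\<And>i j. M $ i $ j = (if i = j then t i else 0)"
  shows "Poly_Mapping.lookup (linear_subst M h) \<alpha> =
    (\<Prod>i\<in>UNIV. t i ^ Poly_Mapping.lookup \<alpha> i) * Poly_Mapping.lookup h \<alpha>"
proof -
  have "(\<Sum>j\<in>UNIV. const_poly (M $ i $ j) * var_poly j) =
      Poly_Mapping.single (Poly_Mapping.single i 1) (t i)" for i
  proof -
    have "(\<Sum>j\<in>UNIV. const_poly (M $ i $ j) * var_poly j) =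
        (\<Sum>j\<in>UNIV. if j = i then Poly_Mapping.single (Poly_Mapping.single i 1) (t i) else 0)"
      by (intro sum.cong) (auto simp: assms const_poly_def var_poly_def mult_single)
    then show ?thesis by simp
  qed
  then have "linear_subst M h = (\<Sum>\<alpha>\<in>Poly_Mapping.keys h. Poly_Mapping.single \<alpha>
      (Poly_Mapping.lookup h \<alpha> * (\<Prod>i\<in>UNIV. t i ^ Poly_Mapping.lookup \<alpha> i)))"
    by (simp add: linear_subst_def single_power[unfolded One_nat_def] prod_single
        sum_single_exponent const_poly_def mult_single)
  then show ?thesis
    by (simp add: lookup_sum lookup_single when_def in_keys_iff)
qed

text \<open>The exponent at \<open>k\<close> is recovered as the multiplicity of \<open>p k\<close>
  in the product, since the other factors are powers of different primes.\<close>

lemma prod_prime_powers_inj: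
  fixes p :: "'n :: finite \<Rightarrow> nat"
  assumes "inj p" "\<And>i. prime (p i)"
    and "(\<Prod>i\<in>UNIV. p i ^ a i) = (\<Prod>i\<in>UNIV. p i ^ b i)"
  shows "a = b"
proof
  have *: "multiplicity (p k) (\<Prod>i\<in>UNIV. p i ^ e i) = e k" for e k
  proof -
    have "multiplicity (p k) (\<Prod>i\<in>UNIV. p i ^ e i) = (\<Sum>i\<in>UNIV. multiplicity (p k) (p i ^ e i))"
      using assms(2) prime_gt_0_nat by (subst prime_elem_multiplicity_prod_distrib)
        (auto simp: prime_imp_prime_elem, metis less_irrefl)
    also have "\<dots> = (\<Sum>i\<in>UNIV. if i = k then e k else 0)"
    proof (intro sum.cong refl)
      fix i
      have "p k \<noteq> p i" if "i \<noteq> k" using assms(1) that by (metis inj_eq)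
      then show "multiplicity (p k) (p i ^ e i) = (if i = k then e k else 0)"
        using assms(2)[of k] assms(2)[of i]
        by (simp add: multiplicity_distinct_prime_power)
    qed
    finally show ?thesis by simp
  qed
  show "a k = b k" for k
    using *[of k a] *[of k b] assms(3) by simp
qed

section \<open>Division with control of the norm\<close>

text \<open>Leading exponent for the order pulled back along \<open>\<phi>\<close>. As a relation it
  leaves the zero polynomial without one; injectivity of \<open>\<phi>\<close> makes it
  unique.\<close>

definition is_leading :: "(('n \<Rightarrow>\<^sub>0 nat) \<Rightarrow> nat) \<Rightarrow> 'n cpoly \<Rightarrow> ('n \<Rightarrow>\<^sub>0 nat) \<Rightarrow> bool" where
  "is_leading \<phi> h \<alpha> \<longleftrightarrow> \<alpha> \<in> Poly_Mapping.keys h \<and> (\<forall>\<beta>\<in>Poly_Mapping.keys h. \<phi> \<beta> \<le> \<phi> \<alpha>)"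

text \<open>Induction on a strict bound \<open>n\<close> for the weights occurring in
  \<open>h\<close>. A step replaces \<open>h\<close> by \<open>h'\<close> with \<open>cmod c\<close>
  at most twice the drop in norm, so the costs of all steps telescope to
  \<open>2 * l1_norm h\<close>.\<close>

lemma ideal_division:
  fixes \<phi> :: "('n :: finite \<Rightarrow>\<^sub>0 nat) \<Rightarrow> nat" and g :: "('n \<Rightarrow>\<^sub>0 nat) \<Rightarrow> 'n cpoly"
  assumes inj: "inj \<phi>" and mult: "\<And>\<alpha> \<beta>. \<phi> (\<alpha> + \<beta>) = \<phi> \<alpha> * \<phi> \<beta>"
    and J: "ring_ideal J" and B: "finite B" "g ` B \<subseteq> J"
    and lead: "\<And>\<beta>. \<beta> \<in> B \<Longrightarrow> is_leading \<phi> (g \<beta>) \<beta>"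
    and monic: "\<And>\<beta>. \<beta> \<in> B \<Longrightarrow> Poly_Mapping.lookup (g \<beta>) \<beta> = 1"
    and small: "\<And>\<beta>. \<beta> \<in> B \<Longrightarrow> l1_norm (g \<beta> - Poly_Mapping.single \<beta> 1) \<le> 1 / 2"
    and cover: "\<And>h \<alpha>. h \<in> J \<Longrightarrow> is_leading \<phi> h \<alpha> \<Longrightarrow> \<exists>\<beta>\<in>B. \<exists>\<gamma>. \<alpha> = \<beta> + \<gamma>"
    and "h \<in> J"
  shows "\<exists>a. h = (\<Sum>\<beta>\<in>B. a \<beta> * g \<beta>) \<and> (\<Sum>\<beta>\<in>B. l1_norm (a \<beta>)) \<le> 2 * l1_norm h"
proof -
  have "\<exists>a. h = (\<Sum>\<beta>\<in>B. a \<beta> * g \<beta>) \<and> (\<Sum>\<beta>\<in>B. l1_norm (a \<beta>)) \<le> 2 * l1_norm h"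
    if "h \<in> J" "\<forall>\<alpha>\<in>Poly_Mapping.keys h. \<phi> \<alpha> < n" for n h
    using that
  proof (induction n arbitrary: h)
    case 0
    then have "h = 0" by (simp flip: keys_eq_empty)
    then show ?case by (intro exI[of _ "\<lambda>_. 0"]) simp
  next
    case (Suc n)
    show ?case
    proof (cases "\<exists>\<alpha>\<in>Poly_Mapping.keys h. \<phi> \<alpha> = n")
      case False
      then have "\<forall>\<alpha>\<in>Poly_Mapping.keys h. \<phi> \<alpha> < n" using Suc.prems(2) by (auto simp: less_Suc_eq)
      then show ?thesis using Suc.IH Suc.prems(1) by blast
    next
      case True
      then obtain \<alpha> where \<alpha>: "\<alpha> \<in> Poly_Mapping.keys h" "\<phi> \<alpha> = n" by blast
      then have "is_leading \<phi> h \<alpha>" using Suc.prems(2) by (auto simp: is_leading_def)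
      then obtain \<beta> \<gamma> where \<beta>: "\<beta> \<in> B" "\<alpha> = \<gamma> + \<beta>"
        using cover Suc.prems(1) by (metis add.commute)
      define c where "c = Poly_Mapping.lookup h \<alpha>"
      define m where "m = Poly_Mapping.single \<gamma> c"
      define h' where "h' = h - m * g \<beta>"
      \<comment> \<open>The two cancelling leading terms are split off, leaving \<open>h\<close>
        without its leading term and \<open>m\<close> times the tail of \<open>g \<beta>\<close>.
        The first has lost \<open>cmod c\<close> of norm, the second has norm at most half of
        that.\<close>
      have h'_eq: "h' = (h - Poly_Mapping.single \<alpha> c) - m * (g \<beta> - Poly_Mapping.single \<beta> 1)"
        by (simp add: h'_def m_def \<beta>(2) mult_single algebra_simps)
      have "l1_norm h' \<le> (l1_norm h - cmod c) + cmod c * l1_norm (g \<beta> - Poly_Mapping.single \<beta> 1)"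
        unfolding h'_eq
        using l1_norm_diff_le[of "h - Poly_Mapping.single \<alpha> c" "m * (g \<beta> - Poly_Mapping.single \<beta> 1)"]
          l1_norm_diff_single[of h \<alpha>] l1_norm_mult_le[of m "g \<beta> - Poly_Mapping.single \<beta> 1"]
        by (simp add: m_def c_def)
      also have "\<dots> \<le> (l1_norm h - cmod c) + cmod c * (1 / 2)"
        using small[OF \<beta>(1)] by (intro add_left_mono mult_left_mono) auto
      finally have norm_h': "cmod c \<le> 2 * l1_norm h - 2 * l1_norm h'" by simp
      have "h' = h + (- m) * g \<beta>" by (simp add: h'_def)
      moreover have "(- m) * g \<beta> \<in> J" using J B(2) \<beta>(1) unfolding ring_ideal_iff by blast
      ultimately have "h' \<in> J" using J Suc.prems(1) unfolding ring_ideal_iff by metis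
      moreover have "\<phi> \<delta> < n" if \<delta>: "\<delta> \<in> Poly_Mapping.keys h'" for \<delta>
      proof -
        \<comment> \<open>Multiplicativity of \<open>\<phi>\<close> keeps the new terms at weight at
          most \<open>n\<close>. By injectivity weight \<open>n\<close> could occur only at
          \<open>\<alpha>\<close>, where the coefficient has been cancelled.\<close>
        have "\<phi> \<delta> \<le> n"
        proof (cases "\<delta> \<in> Poly_Mapping.keys h")
          case True
          then show ?thesis using Suc.prems(2) by auto
        next
          case False
          then have "\<delta> \<in> Poly_Mapping.keys (m * g \<beta>)"
            using \<delta> by (auto simp: h'_def in_keys_iff lookup_minus)
          then obtain \<epsilon> where "\<epsilon> \<in> Poly_Mapping.keys (g \<beta>)" "\<delta> = \<gamma> + \<epsilon>"
            using keys_mult[of m "g \<beta>"] by (auto simp: m_def split: if_splits)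
          then show ?thesis
            using lead[OF \<beta>(1)] \<alpha>(2) \<beta>(2) by (auto simp: is_leading_def mult)
        qed
        moreover have "\<phi> \<delta> \<noteq> n"
        proof
          assume "\<phi> \<delta> = n"
          then have "\<delta> = \<alpha>" using inj \<alpha>(2) by (auto dest: injD)
          moreover have "Poly_Mapping.lookup (m * (g \<beta> - Poly_Mapping.single \<beta> 1)) \<alpha> = 0"
          proof (rule ccontr)
            assume "\<not> ?thesis"
            then have "\<alpha> \<in> Poly_Mapping.keys (m * (g \<beta> - Poly_Mapping.single \<beta> 1))"
              by (simp add: in_keys_iff)
            then have "\<beta> \<in> Poly_Mapping.keys (g \<beta> - Poly_Mapping.single \<beta> 1)"
              using keys_mult[of m "g \<beta> - Poly_Mapping.single \<beta> 1"] \<beta>(2) by (auto simp: m_def split: if_splits)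
            then show False using monic[OF \<beta>(1)] by (simp add: in_keys_iff lookup_minus)
          qed
          ultimately show False
            using \<delta> by (simp add: h'_eq in_keys_iff lookup_minus c_def)
        qed
        ultimately show ?thesis by simp
      qed
      ultimately obtain a where a: "h' = (\<Sum>\<beta>\<in>B. a \<beta> * g \<beta>)"
        "(\<Sum>\<beta>\<in>B. l1_norm (a \<beta>)) \<le> 2 * l1_norm h'"
        using Suc.IH by blast
      \<comment> \<open>Only the quotient at \<open>\<beta>\<close> changes. Its norm grows by at
        most \<open>cmod c\<close>, which \<open>norm_h'\<close> absorbs into the passage from
        \<open>h'\<close> to \<open>h\<close>.\<close>
      define a' where "a' = a(\<beta> := a \<beta> + m)"
      have "h = m * g \<beta> + h'" by (simp add: h'_def)
      also have "\<dots> = (\<Sum>\<beta>\<in>B. a' \<beta> * g \<beta>)"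
        using B(1) \<beta>(1) by (simp add: a(1) sum.remove[of B \<beta>] a'_def algebra_simps)
      finally have "h = (\<Sum>\<beta>\<in>B. a' \<beta> * g \<beta>)" .
      moreover have "(\<Sum>\<beta>\<in>B. l1_norm (a' \<beta>)) \<le> (\<Sum>\<beta>\<in>B. l1_norm (a \<beta>)) + cmod c"
        using B(1) \<beta>(1) l1_norm_add_le[of "a \<beta>" m]
        by (simp add: sum.remove[of B \<beta>] a'_def m_def)
      ultimately show ?thesis using a(2) norm_h' by (intro exI[of _ a']) linarith
    qed
  qed
  \<comment> \<open>\<open>Suc\<close> turns the maximal weight into a strict bound. For
    \<open>h = 0\<close> the bound condition is vacuous, whatever \<open>Max\<close> of the empty
    set is.\<close>
  from this[OF \<open>h \<in> J\<close>, of "Suc (Max (\<phi> ` Poly_Mapping.keys h))"] show ?thesis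
    by (simp add: less_Suc_eq_le)
qed

text \<open>\<open>\<beta>\<close> can be read off from \<open>g \<beta>\<close> as its unique
  leading exponent. This permits reindexing sums over \<open>B\<close> as sums over the set of
  generators.\<close>

lemma is_leading_inj_on:
  assumes "inj \<phi>" "\<And>\<beta>. \<beta> \<in> B \<Longrightarrow> is_leading \<phi> (g \<beta>) \<beta>"
  shows "inj_on g B"
  using assms unfolding inj_on_def is_leading_def by (metis UNIV_I order_antisym)

text \<open>Each generator has norm at most \<open>1 + 1/2\<close>, so the quotient bound 2 becomes
  \<open>2 * (3/2) = 3\<close> for the products. A sum of squares of nonnegative reals is at most
  the square of their sum, which gives the constant 9.\<close>

lemma stable_division_property_l1_norm:
  fixes \<phi> :: "('n :: finite \<Rightarrow>\<^sub>0 nat) \<Rightarrow> nat" and g :: "('n \<Rightarrow>\<^sub>0 nat) \<Rightarrow> 'n cpoly"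
  assumes inj: "inj \<phi>" and mult: "\<And>\<alpha> \<beta>. \<phi> (\<alpha> + \<beta>) = \<phi> \<alpha> * \<phi> \<beta>"
    and J: "ring_ideal J" and B: "finite B" "g ` B \<subseteq> J"
    and lead: "\<And>\<beta>. \<beta> \<in> B \<Longrightarrow> is_leading \<phi> (g \<beta>) \<beta>"
    and monic: "\<And>\<beta>. \<beta> \<in> B \<Longrightarrow> Poly_Mapping.lookup (g \<beta>) \<beta> = 1"
    and small: "\<And>\<beta>. \<beta> \<in> B \<Longrightarrow> l1_norm (g \<beta> - Poly_Mapping.single \<beta> 1) \<le> 1 / 2"
    and cover: "\<And>h \<alpha>. h \<in> J \<Longrightarrow> is_leading \<phi> h \<alpha> \<Longrightarrow> \<exists>\<beta>\<in>B. \<exists>\<gamma>. \<alpha> = \<beta> + \<gamma>"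
  shows "stable_division_property l1_norm J"
proof -
  have inj_g: "inj_on g B" using inj lead by (rule is_leading_inj_on)
  have norm_g: "l1_norm (g \<beta>) \<le> 3 / 2" if "\<beta> \<in> B" for \<beta>
    using l1_norm_add_le[of "g \<beta> - Poly_Mapping.single \<beta> 1" "Poly_Mapping.single \<beta> 1"] small[OF that]
    by simp
  have division: "\<exists>a. h = (\<Sum>f\<in>g ` B. a f * f) \<and> (\<Sum>f\<in>g ` B. (l1_norm (a f * f))\<^sup>2) \<le> 9 * (l1_norm h)\<^sup>2"
    if h: "h \<in> J" for h
  proof -
    have "\<exists>a. h = (\<Sum>\<beta>\<in>B. a \<beta> * g \<beta>) \<and> (\<Sum>\<beta>\<in>B. l1_norm (a \<beta>)) \<le> 2 * l1_norm h"
      using inj mult J B lead monic small cover h by (rule ideal_division)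
    then obtain a where
      a: "h = (\<Sum>\<beta>\<in>B. a \<beta> * g \<beta>)" "(\<Sum>\<beta>\<in>B. l1_norm (a \<beta>)) \<le> 2 * l1_norm h"
      by blast
    have "L2_set (\<lambda>\<beta>. l1_norm (a \<beta> * g \<beta>)) B \<le> (\<Sum>\<beta>\<in>B. l1_norm (a \<beta> * g \<beta>))"
      by (rule L2_set_le_sum) simp
    also have "\<dots> \<le> (\<Sum>\<beta>\<in>B. l1_norm (a \<beta>) * (3 / 2))"
      by (intro sum_mono order.trans[OF l1_norm_mult_le] mult_left_mono norm_g) auto
    also have "\<dots> \<le> 3 * l1_norm h"
      using a(2) by (subst sum_distrib_right[symmetric]) simp
    finally have "(L2_set (\<lambda>\<beta>. l1_norm (a \<beta> * g \<beta>)) B)\<^sup>2 \<le> (3 * l1_norm h)\<^sup>2"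
      by (rule power_mono) simp
    then have "(\<Sum>\<beta>\<in>B. (l1_norm (a \<beta> * g \<beta>))\<^sup>2) \<le> 9 * (l1_norm h)\<^sup>2"
      by (simp add: L2_set_def power_mult_distrib sum_nonneg)
    then show ?thesis
      \<comment> \<open>The quotients are indexed by exponents, while the property indexes them by
        generators; \<open>inv_into B g\<close> translates.\<close>
      by (intro exI[of _ "\<lambda>f. a (inv_into B g f)"] conjI)
        (simp_all add: sum.reindex[OF inj_g] inv_into_f_f[OF inj_g] flip: a(1))
  qed
  have "ideal_generated_by (g ` B) = J"
  proof
    show "ideal_generated_by (g ` B) \<subseteq> J"
      using J B(2) by (auto simp: ideal_generated_by_eq)
    have "(\<Sum>f\<in>g ` B. a f * f) \<in> ideal_generated_by (g ` B)" for a
      unfolding ideal_generated_by_def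
      by (intro module.span_sum[OF module_times] module.span_scale[OF module_times]
          module.span_base[OF module_times])
    then show "J \<subseteq> ideal_generated_by (g ` B)" by (auto dest!: division)
  qed
  then show ?thesis
    unfolding stable_division_property_def using B division
    by (intro exI[of _ "g ` B"] exI[of _ 9] conjI ballI) simp_all
qed

section \<open>Existence of a monic Groebner basis\<close>

text \<open>Dickson's lemma is applied to the set of all leading exponents of elements of
  \<open>I\<close>; for each chosen exponent a witness in \<open>I\<close> is divided by its leading
  coefficient.\<close>

lemma ideal_groebner_basis:
  fixes \<phi> :: "('n :: finite \<Rightarrow>\<^sub>0 nat) \<Rightarrow> nat"
  assumes I: "ring_ideal I"
  obtains B g where "finite B" "g ` B \<subseteq> I" "\<And>\<beta>. \<beta> \<in> B \<Longrightarrow> is_leading \<phi> (g \<beta>) \<beta>"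
    "\<And>\<beta>. \<beta> \<in> B \<Longrightarrow> Poly_Mapping.lookup (g \<beta>) \<beta> = 1"
    "\<And>h \<alpha>. h \<in> I \<Longrightarrow> is_leading \<phi> h \<alpha> \<Longrightarrow> \<exists>\<beta>\<in>B. \<exists>\<gamma>. \<alpha> = \<beta> + \<gamma>"
proof -
  define A where "A = {\<alpha>. \<exists>h\<in>I. is_leading \<phi> h \<alpha>}"
  obtain B where B: "B \<subseteq> A" "finite B" "\<forall>\<alpha>\<in>A. \<exists>\<beta>\<in>B. \<exists>\<gamma>. \<alpha> = \<beta> + \<gamma>"
    using dickson by blast
  have "\<exists>f\<in>I. is_leading \<phi> f \<beta> \<and> Poly_Mapping.lookup f \<beta> = 1" if "\<beta> \<in> B" for \<beta>
  proof -
    obtain h where h: "h \<in> I" "is_leading \<phi> h \<beta>" using \<open>\<beta> \<in> B\<close> B(1) by (auto simp: A_def)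
    define c where "c = Poly_Mapping.lookup h \<beta>"
    define f where "f = const_poly (inverse c) * h"
    have f: "Poly_Mapping.lookup f \<delta> = inverse c * Poly_Mapping.lookup h \<delta>" for \<delta>
      by (simp add: f_def)
    have "c \<noteq> 0" using h(2) by (auto simp: c_def is_leading_def in_keys_iff)
    then have "is_leading \<phi> f \<beta> \<and> Poly_Mapping.lookup f \<beta> = 1"
      using h(2) by (auto simp: is_leading_def in_keys_iff f c_def)
    moreover have "f \<in> I" using I h(1) by (simp add: f_def ring_ideal_iff)
    ultimately show ?thesis by blast
  qed
  then obtain g where "\<And>\<beta>. \<beta> \<in> B \<Longrightarrow> g \<beta> \<in> I \<and> is_leading \<phi> (g \<beta>) \<beta> \<and> Poly_Mapping.lookup (g \<beta>) \<beta> = 1"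
    by metis
  then show ?thesis using B by (intro that[of B g]) (auto simp: A_def)
qed

section \<open>Diagonal scalings of ideals and of basis elements\<close>

text \<open>\<open>T\<close> is additive, so it suffices to compare products of monomials, where the
  claim is multiplicativity of the weight \<open>w\<close>.\<close>

lemma diagonal_scaling_mult:
  fixes T :: "'n cpoly \<Rightarrow> 'n cpoly"
  assumes T: "\<And>h \<alpha>. Poly_Mapping.lookup (T h) \<alpha> = w \<alpha> * Poly_Mapping.lookup h \<alpha>"
    and w: "\<And>\<alpha> \<beta>. w (\<alpha> + \<beta>) = w \<alpha> * w \<beta>"
  shows "T (g * h) = T g * T h"
proof -
  have T_sum: "T (sum f A) = (\<Sum>x\<in>A. T (f x))" for f and A :: "'b set"
    by (rule poly_mapping_eqI) (simp add: T lookup_sum sum_distrib_left)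
  have T_single: "T (Poly_Mapping.single \<alpha> c) = Poly_Mapping.single \<alpha> (w \<alpha> * c)" for \<alpha> c
    by (rule poly_mapping_eqI) (simp add: T lookup_single when_def)
  have "T ((\<Sum>\<alpha>\<in>Poly_Mapping.keys g. Poly_Mapping.single \<alpha> (Poly_Mapping.lookup g \<alpha>)) *
       (\<Sum>\<alpha>\<in>Poly_Mapping.keys h. Poly_Mapping.single \<alpha> (Poly_Mapping.lookup h \<alpha>))) =
     T (\<Sum>\<alpha>\<in>Poly_Mapping.keys g. Poly_Mapping.single \<alpha> (Poly_Mapping.lookup g \<alpha>)) *
     T (\<Sum>\<alpha>\<in>Poly_Mapping.keys h. Poly_Mapping.single \<alpha> (Poly_Mapping.lookup h \<alpha>))"
    by (simp only: sum_product T_sum T_single mult_single w) (simp add: mult_ac)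
  then show ?thesis by (simp only: single_poly_sum)
qed

text \<open>\<open>T\<close> is a ring homomorphism, and it is surjective because coefficients can
  be divided by the nonzero weights. Surjective homomorphisms map ideals to ideals.\<close>

lemma diagonal_scaling_ideal:
  fixes T :: "'n cpoly \<Rightarrow> 'n cpoly"
  assumes T: "\<And>h \<alpha>. Poly_Mapping.lookup (T h) \<alpha> = w \<alpha> * Poly_Mapping.lookup h \<alpha>"
    and w: "\<And>\<alpha> \<beta>. w (\<alpha> + \<beta>) = w \<alpha> * w \<beta>" "\<And>\<alpha>. w \<alpha> \<noteq> 0"
    and I: "ring_ideal I"
  shows "ring_ideal (T ` I)"
proof -
  have "T (g + h) = T g + T h" for g h
    by (rule poly_mapping_eqI) (simp add: T lookup_add algebra_simps)
  moreover have "T 0 = 0" by (rule poly_mapping_eqI) (simp add: T)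
  moreover have "\<exists>g. T g = h" for h
    by (rule exI[of _ "\<Sum>\<alpha>\<in>Poly_Mapping.keys h. Poly_Mapping.single \<alpha> (Poly_Mapping.lookup h \<alpha> / w \<alpha>)"],
        rule poly_mapping_eqI) (simp add: T lookup_sum lookup_single when_def in_keys_iff w(2))
  moreover have "T (g * h) = T g * T h" for g h
    using T w(1) by (rule diagonal_scaling_mult)
  ultimately show ?thesis
    using I unfolding ring_ideal_iff by (auto simp: image_iff) metis+
qed

text \<open>At \<open>\<beta>\<close> the ratio of weights is 1, so the leading term stays fixed. At
  each of the finitely many other exponents the ratio is strictly below 1, by injectivity of
  \<open>\<phi>\<close>, and its powers tend to 0.\<close>

lemma weight_scaling_tendsto:
  fixes \<phi> :: "('n \<Rightarrow>\<^sub>0 nat) \<Rightarrow> nat"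
  assumes "inj \<phi>" "\<And>\<alpha>. \<phi> \<alpha> > 0" "is_leading \<phi> f \<beta>" "Poly_Mapping.lookup f \<beta> = 1"
    and u: "\<And>s \<alpha>. Poly_Mapping.lookup (u s) \<alpha> = (of_nat (\<phi> \<alpha>) / of_nat (\<phi> \<beta>)) ^ s * Poly_Mapping.lookup f \<alpha>"
  shows "(\<lambda>s. l1_norm (u s - Poly_Mapping.single \<beta> 1)) \<longlonglongrightarrow> 0"
proof -
  define A where "A = Poly_Mapping.keys f - {\<beta>}"
  have "l1_norm (u s - Poly_Mapping.single \<beta> 1) =
      (\<Sum>\<alpha>\<in>A. (real (\<phi> \<alpha>) / real (\<phi> \<beta>)) ^ s * cmod (Poly_Mapping.lookup f \<alpha>))" for s
  proof -
    have "Poly_Mapping.keys (u s - Poly_Mapping.single \<beta> 1) \<subseteq> A"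
      using assms(2)[of \<beta>] assms(4)
      by (auto simp: A_def in_keys_iff lookup_minus lookup_single when_def u split: if_splits)
    moreover have "cmod (Poly_Mapping.lookup (u s - Poly_Mapping.single \<beta> 1) \<alpha>) =
        (real (\<phi> \<alpha>) / real (\<phi> \<beta>)) ^ s * cmod (Poly_Mapping.lookup f \<alpha>)" if "\<alpha> \<in> A" for \<alpha>
      using that by (auto simp: A_def lookup_minus lookup_single_not_eq u norm_mult norm_power norm_divide)
    moreover have "finite A" by (simp add: A_def)
    ultimately show ?thesis by (simp add: l1_norm_superset[of A])
  qed
  moreover have "(\<lambda>s. \<Sum>\<alpha>\<in>A. (real (\<phi> \<alpha>) / real (\<phi> \<beta>)) ^ s * cmod (Poly_Mapping.lookup f \<alpha>)) \<longlonglongrightarrow> 0"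
  proof (rule tendsto_null_sum)
    fix \<alpha> assume "\<alpha> \<in> A"
    then have "\<phi> \<alpha> \<le> \<phi> \<beta>" "\<phi> \<alpha> \<noteq> \<phi> \<beta>"
      using assms(1,3) by (auto simp: A_def is_leading_def dest: injD)
    then have "real (\<phi> \<alpha>) / real (\<phi> \<beta>) < 1" using assms(2)[of \<beta>] by simp
    then show "(\<lambda>s. (real (\<phi> \<alpha>) / real (\<phi> \<beta>)) ^ s * cmod (Poly_Mapping.lookup f \<alpha>)) \<longlonglongrightarrow> 0"
      by (intro tendsto_mult_left_zero LIMSEQ_power_zero) simp
  qed
  ultimately show ?thesis by simp
qed

section \<open>Choice of the primes and of the scaling\<close>

theorem theorem3p6:
  fixes I :: "'n :: finite cpoly set"
  assumes "ring_ideal I"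
  shows "\<exists>J :: 'n cpoly set. ring_ideal J \<and> linearly_equivalent I J \<and>
           stable_division_property l1_norm J"
proof -
  obtain p :: "'n \<Rightarrow> nat" where p: "inj p" "\<And>i. prime (p i)"
  proof -
    obtain P :: "nat set" where "P \<subseteq> {p. prime p}" "finite P" "card P = CARD('n)"
      using infinite_arbitrarily_large[OF primes_infinite] by metis
    moreover from this obtain q :: "'n \<Rightarrow> nat" where "bij_betw q UNIV P"
      using finite_same_card_bij[of "UNIV :: 'n set" P] by auto
    ultimately show ?thesis
      by (intro that[of q]) (auto simp: bij_betw_def)
  qed
  define \<phi> :: "('n \<Rightarrow>\<^sub>0 nat) \<Rightarrow> nat"
    where "\<phi> \<alpha> = (\<Prod>i\<in>UNIV. p i ^ Poly_Mapping.lookup \<alpha> i)" for \<alpha>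
  have inj: "inj \<phi>"
    using prod_prime_powers_inj[OF p] by (intro injI poly_mapping_eqI) (metis \<phi>_def)
  have mult: "\<phi> (\<alpha> + \<beta>) = \<phi> \<alpha> * \<phi> \<beta>" for \<alpha> \<beta>
    by (simp add: \<phi>_def lookup_add power_add prod.distrib)
  have pos: "\<phi> \<alpha> > 0" for \<alpha>
    using p(2) by (simp add: \<phi>_def prime_gt_0_nat prod_pos)
  obtain B g where B: "finite B" "g ` B \<subseteq> I" "\<And>\<beta>. \<beta> \<in> B \<Longrightarrow> is_leading \<phi> (g \<beta>) \<beta>"
    "\<And>\<beta>. \<beta> \<in> B \<Longrightarrow> Poly_Mapping.lookup (g \<beta>) \<beta> = 1"
    "\<And>h \<alpha>. h \<in> I \<Longrightarrow> is_leading \<phi> h \<alpha> \<Longrightarrow> \<exists>\<beta>\<in>B. \<exists>\<gamma>. \<alpha> = \<beta> + \<gamma>"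
    by (rule ideal_groebner_basis[OF assms, of \<phi>]) blast
  define M :: "nat \<Rightarrow> complex ^ 'n ^ 'n"
    where "M s = (\<chi> i j. if i = j then of_nat (p i) ^ s else 0)" for s
  define T where "T s = linear_subst (M s)" for s
  have T: "Poly_Mapping.lookup (T s h) \<alpha> = of_nat (\<phi> \<alpha>) ^ s * Poly_Mapping.lookup h \<alpha>" for s h \<alpha>
    unfolding T_def
    by (subst lookup_linear_subst_diagonal[where t = "\<lambda>i. of_nat (p i) ^ s"])
      (simp_all add: M_def \<phi>_def prod_power_distrib mult.commute flip: power_mult)
  \<comment> \<open>Scaling turns the leading coefficient 1 of \<open>g \<beta>\<close> into
    \<open>\<phi> \<beta> ^ s\<close>; dividing by it makes the element monic again and keeps it in
    the scaled ideal.\<close>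
  define u where "u s \<beta> = const_poly (inverse (of_nat (\<phi> \<beta>) ^ s)) * T s (g \<beta>)" for s \<beta>
  have u: "Poly_Mapping.lookup (u s \<beta>) \<alpha> =
      (of_nat (\<phi> \<alpha>) / of_nat (\<phi> \<beta>)) ^ s * Poly_Mapping.lookup (g \<beta>) \<alpha>" for s \<alpha> \<beta>
    by (simp add: u_def T) (simp add: field_simps power_divide)
  \<comment> \<open>Since \<open>B\<close> is finite, one exponent \<open>s\<close> serves all basis
    elements at once.\<close>
  have "\<forall>\<^sub>F s in sequentially. \<forall>\<beta>\<in>B. l1_norm (u s \<beta> - Poly_Mapping.single \<beta> 1) < 1 / 2"
  proof (intro eventually_ball_finite B(1) ballI)
    fix \<beta> assume "\<beta> \<in> B"
    then have "(\<lambda>s. l1_norm (u s \<beta> - Poly_Mapping.single \<beta> 1)) \<longlonglongrightarrow> 0"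
      using weight_scaling_tendsto[OF inj pos B(3,4) u] by blast
    then show "\<forall>\<^sub>F s in sequentially. l1_norm (u s \<beta> - Poly_Mapping.single \<beta> 1) < 1 / 2"
      by (rule order_tendstoD) simp
  qed
  then obtain s where s: "\<And>\<beta>. \<beta> \<in> B \<Longrightarrow> l1_norm (u s \<beta> - Poly_Mapping.single \<beta> 1) < 1 / 2"
    using eventually_happens'[OF sequentially_bot] by blast
  define J where "J = T s ` I"
  have J: "ring_ideal J"
    unfolding J_def
  proof (rule diagonal_scaling_ideal[OF T _ _ assms])
    show "of_nat (\<phi> (\<alpha> + \<beta>)) ^ s = of_nat (\<phi> \<alpha>) ^ s * (of_nat (\<phi> \<beta>) ^ s :: complex)" for \<alpha> \<beta>
      by (simp add: mult power_mult_distrib)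
    show "of_nat (\<phi> \<alpha>) ^ s \<noteq> (0 :: complex)" for \<alpha>
      using pos[of \<alpha>] by simp
  qed
  \<comment> \<open>The nonzero weights preserve supports, so the scaled ideal has the same leading
    exponents as \<open>I\<close> and \<open>B\<close> still covers them.\<close>
  have T_lead: "is_leading \<phi> (T s h) \<alpha> \<longleftrightarrow> is_leading \<phi> h \<alpha>" for h \<alpha>
  proof -
    have "\<phi> \<delta> \<noteq> 0" for \<delta> using pos[of \<delta>] by simp
    then have "Poly_Mapping.keys (T s h) = Poly_Mapping.keys h" by (simp add: set_eq_iff in_keys_iff T)
    then show ?thesis by (simp add: is_leading_def)
  qed
  have "stable_division_property l1_norm J"
  proof (rule stable_division_property_l1_norm[OF inj mult J B(1)])
    show "u s ` B \<subseteq> J"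
      using J B(2) by (auto simp: ring_ideal_iff u_def J_def)
    show "is_leading \<phi> (u s \<beta>) \<beta>" "Poly_Mapping.lookup (u s \<beta>) \<beta> = 1" if "\<beta> \<in> B" for \<beta>
      using B(3,4)[OF that] pos[of \<beta>] by (auto simp: is_leading_def in_keys_iff u)
    show "l1_norm (u s \<beta> - Poly_Mapping.single \<beta> 1) \<le> 1 / 2" if "\<beta> \<in> B" for \<beta>
      using s[OF that] by simp
    show "\<exists>\<beta>\<in>B. \<exists>\<gamma>. \<alpha> = \<beta> + \<gamma>" if "h \<in> J" "is_leading \<phi> h \<alpha>" for h \<alpha>
      using that B(5) by (auto simp: J_def T_lead)
  qed
  moreover have "invertible (M s)"
    using prime_gt_0_nat[OF p(2)] by (simp add: invertible_det_nz det_diagonal M_def)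
  then have "linearly_equivalent I J"
    unfolding linearly_equivalent_def J_def T_def by blast
  ultimately show ?thesis using J by blast
qed

end
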